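(* Let $L=4D_4^{\mathcal G}\oplus\mathcal{G}_{1,1}$, let $\{s_v:v\in D\}$ be the $32$ roots of $L$ listed in the context, and let $\tau=e^{-\pi i/4}l_\infty-p_\infty$. Then the $32$ mirrors $\{s_v^\perp:v\in D\}$ are precisely the mirrors of $R(L)$ closest to (the point of $\mathbb{B}(L)$ determined by) $\tau$. In particular, $\tau$ does not lie on any mirror.
   Context: Let $\mathcal{G}=\mathbb{Z}[i]$, $p=1+i$. Hermitian forms are linear in the second variable and $v^2=\langle v|v\rangle$. $D_4^{\mathcal G}=\{(x_1,x_2)\in\mathcal{G}^2:x_1+x_2\equiv0\bmod p\}$ with form $\bar x_1x_1'+\bar x_2x_2'$; $\mathcal{G}_{1,1}=\mathcal{G}^2$ with form $\langle (m,n)|(m',n')\rangle=\bar m\bar pn'+\bar npm'$; $L=4D_4^{\mathcal G}\oplus\mathcal{G}_{1,1}$ has signature $(9,1)$. Elements of $L\otimes\mathbb{C}$ are written $(x_1,x_2,x_3,x_4;m,n)$ with blocks $x_j\in\mathbb{C}^2$. A root of $L$ is a vector of norm $2$, and the mirrors of $R(L)$ are the hyperplanes $r^\perp=\mathbb{B}(r^\perp)$, $r$ a root, in the complex hyperbolic space $\mathbb{B}(L)$ of negative definite complex lines in $L\otimes\mathbb{C}$. For $v$ of negative norm and $r$ of positive norm, $d(r^\perp,v)=\sinh^{-1}\sqrt{|\langle r|v\rangle|^2/(-r^2v^2)}$. The index set $D$ consists of $32$ symbols $a,z,c_k,g_k,e_{jk},b_k,d_k,f_k,h_k$ ($1\le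 k\le4$; $1\le j<k\le4$ for $e_{jk}$). The roots are: - $s_a$: all blocks $(0,0)$; $(m,n)=(-1,-1)$. - $s_{c_k}$: block $k$ is $(-1,1)$, other blocks $0$; $(m,n)=(0,0)$. - $s_{e_{jk}}$: blocks $j,k$ are $(-1,-1)$, others $0$; $(m,n)=(-i,-1)$. - $s_{g_k}$: block $k$ is $(0,-2)$, others $(-1,-1)$; $(m,n)=(-2i,-2)$. - $s_z$: all blocks $(-1,-1)$; $(m,n)=(1-2i,-1)$. - $s_{f_k}$: block $k$ is $(0,0)$, others $(0,p)$; $(m,n)=(ip,p)$. - $s_{b_k}$: block $k$ is $(0,p)$, others $0$; $(m,n)=(-1,0)$. - $s_{d_k}$: block $k$ is $(-p,0)$, others $0$; $(m,n)=(0,0)$. - $s_{h_k}$: block $k$ is $(p,p)$, others $(0,p)$; $(m,n)=(p-3,p)$. Finally $p_\infty=s_a+s_z=-(1,1,1,1,1,1,1,1;2i,2)$ and $l_\infty=s_{d_1}+s_{h_1}=(0,p,0,p,0,p,0,p;p-3,p)$; these are null vectors of $L$, and $\tau$ has negative norm. *)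

theory Defs
  imports "HOL-Analysis.Analysis"
begin

definition gaussian :: "complex set" where
  "gaussian = {z. Re z \<in> \<int> \<and> Im z \<in> \<int>}"

definition p :: complex where
  "p = 1 + \<i>"

definition D4 :: "(complex \<times> complex) set" where
  "D4 = {(x1, x2). x1 \<in> gaussian \<and> x2 \<in> gaussian \<and> (\<exists>w\<in>gaussian. x1 + x2 = p * w)}"

text \<open>
  The complex vector space spanned by the lattice \<open>L\<close>: an element \<open>(x, m, n)\<close> consists of four
  blocks \<open>x $ k\<close> in \<open>\<complex>\<^sup>2\<close> and the two coordinates \<open>m\<close>, \<open>n\<close>.  Addition, subtraction and zero are
  those of the library; multiplication by a complex scalar is \<open>cscale\<close>.
  The blocks are indexed by the four-element type \<open>4\<close>, in which the numeral 4 denotes 0.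
\<close>

type_synonym vec10 = "((complex \<times> complex)^4) \<times> complex \<times> complex"

fun cscale :: "complex \<Rightarrow> vec10 \<Rightarrow> vec10" where
  "cscale c (x, m, n) = ((\<chi> k. (c * fst (x $ k), c * snd (x $ k))), c * m, c * n)"

fun herm :: "vec10 \<Rightarrow> vec10 \<Rightarrow> complex" where
  "herm (x, m, n) (x', m', n') =
     (\<Sum>k\<in>UNIV. cnj (fst (x $ k)) * fst (x' $ k) + cnj (snd (x $ k)) * snd (x' $ k))
     + (cnj m * cnj p * n' + cnj n * p * m')"

text \<open>The norm \<open>v\<^sup>2\<close>; it is real because the form is Hermitian (see \<open>herm_self\<close> below).\<close>

definition nrm :: "vec10 \<Rightarrow> real" where
  "nrm v = Re (herm v v)"

definition L :: "vec10 set" where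
  "L = {(x, m, n). (\<forall>k. x $ k \<in> D4) \<and> m \<in> gaussian \<and> n \<in> gaussian}"

definition is_root :: "vec10 \<Rightarrow> bool" where
  "is_root r \<longleftrightarrow> r \<in> L \<and> nrm r = 2"

definition cline :: "vec10 \<Rightarrow> vec10 set" where
  "cline v = range (\<lambda>c. cscale c v)"

text \<open>Complex hyperbolic space: the set of negative definite complex lines.\<close>

definition hyp :: "vec10 set set" where
  "hyp = {cline v | v. nrm v < 0}"

definition mirror :: "vec10 \<Rightarrow> vec10 set set" where
  "mirror r = {l \<in> hyp. \<forall>v\<in>l. herm r v = 0}"

definition mirrors :: "vec10 set set set" where
  "mirrors = {mirror r | r. is_root r}"

text \<open>
  The hyperbolic distance \<open>d(r\<^sup>\<bottom>, v)\<close> between the hyperplane \<open>mirror r\<close> and the point \<open>cline v\<close>,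
  for \<open>r\<close> of positive and \<open>v\<close> of negative norm.  It is unchanged when \<open>r\<close> or \<open>v\<close> is rescaled.
\<close>

definition mirror_dist :: "vec10 \<Rightarrow> vec10 \<Rightarrow> real" where
  "mirror_dist r v = arsinh (sqrt ((cmod (herm r v))\<^sup>2 / - (nrm r * nrm v)))"

definition closest_mirrors :: "vec10 \<Rightarrow> vec10 set set set" where
  "closest_mirrors v =
     {mirror r | r. is_root r \<and> (\<forall>r'. is_root r' \<longrightarrow> mirror_dist r v \<le> mirror_dist r' v)}"

text \<open>
  The symbols \<open>a, z, c\<^sub>k, g\<^sub>k, e\<^sub>j\<^sub>k, b\<^sub>k, d\<^sub>k, f\<^sub>k, h\<^sub>k\<close>.  For \<open>e\<^sub>j\<^sub>k\<close> one symbol is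
  kept for each unordered pair \<open>{j, k}\<close>, by requiring \<open>j < k\<close> in the linear order of the type \<open>4\<close>;
  the root attached to it is symmetric in \<open>j\<close> and \<open>k\<close>.
\<close>

datatype node = Na | Nz | Nc 4 | Ng 4 | Ne 4 4 | Nb 4 | Nd 4 | Nf 4 | Nh 4

definition D :: "node set" where
  "D = {Na, Nz} \<union> range Nc \<union> range Ng \<union> {Ne j k | j k. j < k}
       \<union> range Nb \<union> range Nd \<union> range Nf \<union> range Nh"

fun sroot :: "node \<Rightarrow> vec10" where
  "sroot Na = ((\<chi> i. (0, 0)), -1, -1)"
| "sroot (Nc k) = ((\<chi> i. if i = k then (-1, 1) else (0, 0)), 0, 0)"
| "sroot (Ne j k) = ((\<chi> i. if i = j \<or> i = k then (-1, -1) else (0, 0)), -\<i>, -1)"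
| "sroot (Ng k) = ((\<chi> i. if i = k then (0, -2) else (-1, -1)), -2 * \<i>, -2)"
| "sroot Nz = ((\<chi> i. (-1, -1)), 1 - 2 * \<i>, -1)"
| "sroot (Nf k) = ((\<chi> i. if i = k then (0, 0) else (0, p)), \<i> * p, p)"
| "sroot (Nb k) = ((\<chi> i. if i = k then (0, p) else (0, 0)), -1, 0)"
| "sroot (Nd k) = ((\<chi> i. if i = k then (-p, 0) else (0, 0)), 0, 0)"
| "sroot (Nh k) = ((\<chi> i. if i = k then (p, p) else (0, p)), p - 3, p)"

definition p_inf :: vec10 where
  "p_inf = sroot Na + sroot Nz"

definition l_inf :: vec10 where
  "l_inf = sroot (Nd 1) + sroot (Nh 1)"

definition tau :: vec10 where
  "tau = cscale (exp (- (of_real pi * \<i> / 4))) l_inf - p_inf"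

text \<open>Facts on which the definitions rely: the listed vectors are 32 roots, \<open>p_inf\<close> and \<open>l_inf\<close>
  are null vectors, and \<open>tau\<close> determines a point of complex hyperbolic space.\<close>

lemma herm_cnj: "cnj (herm v w) = herm w v"
  by (cases v; cases w) (simp add: algebra_simps)

lemma herm_self: "herm v v = of_real (nrm v)"
  using herm_cnj[of v v] by (simp add: nrm_def complex_eq_iff)

lemma all4: "(\<forall>k::4. P k) \<longleftrightarrow> P 0 \<and> P 1 \<and> P 2 \<and> P 3"
proof -
  have "(4::4) = 0" by simp
  then show ?thesis by (metis forall_4)
qed

lemma sum4': "(\<Sum>k\<in>(UNIV::4 set). f k) = f 1 + f 2 + f 3 + f 0"
proof -
  have "(4::4) = 0" by simp
  then show ?thesis by (metis sum_4)
qed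

lemma p_inf_eq: "p_inf = - ((\<chi> i. (1, 1)), 2 * \<i>, 2)"
  by (simp add: p_inf_def vec_eq_iff)

lemma l_inf_eq: "l_inf = ((\<chi> i. (0, p)), p - 3, p)"
  by (simp add: l_inf_def vec_eq_iff)

lemma null_cusps: "nrm p_inf = 0" "nrm l_inf = 0"
  by (simp_all add: p_inf_eq l_inf_eq nrm_def p_def)

lemma exp_tau: "exp (- (of_real pi * \<i> / 4)) = (1 - \<i>) / sqrt 2"
proof -
  have "exp (- (of_real pi * \<i> / 4)) = cis (- (pi / 4))"
    by (simp add: cis_conv_exp mult.commute)
  also have "\<dots> = (1 - \<i>) / sqrt 2"
    by (simp add: complex_eq_iff cos_45 sin_45 field_simps)
  finally show ?thesis .
qed

lemma nrm_tau: "nrm tau = - 4 * sqrt 2"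
  unfolding tau_def exp_tau
  by (simp add: p_inf_eq l_inf_eq nrm_def p_def field_simps)

lemma tau_in_hyp: "cline tau \<in> hyp"
  unfolding hyp_def by (rule CollectI, rule exI[of _ tau]) (simp add: nrm_tau)

lemma gaussian_simps [simp]:
  "0 \<in> gaussian" "1 \<in> gaussian" "\<i> \<in> gaussian" "numeral n \<in> gaussian"
  by (simp_all add: gaussian_def)

lemma gaussian_closed [intro, simp]:
  assumes "x \<in> gaussian" "y \<in> gaussian"
  shows "x + y \<in> gaussian" "x - y \<in> gaussian" "x * y \<in> gaussian"
  using assms by (auto simp: gaussian_def)

lemma gaussian_minus [simp]: "- x \<in> gaussian \<longleftrightarrow> x \<in> gaussian"
  by (simp add: gaussian_def)

lemma p_gaussian [simp]: "p \<in> gaussian"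
  by (simp add: p_def)

lemma D4_simps [simp]:
  "(0, 0) \<in> D4" "(-1, 1) \<in> D4" "(-1, -1) \<in> D4" "(0, -2) \<in> D4"
  "(0, p) \<in> D4" "(-p, 0) \<in> D4" "(p, p) \<in> D4"
proof -
  have two: "-2 = p * (\<i> - 1)" by (simp add: p_def algebra_simps)
  show "(0, 0) \<in> D4" "(-1, 1) \<in> D4" by (auto simp: D4_def intro!: bexI[of _ 0])
  show "(-1, -1) \<in> D4" "(0, -2) \<in> D4" using two by (auto simp: D4_def intro!: bexI[of _ "\<i> - 1"])
  show "(0, p) \<in> D4" by (auto simp: D4_def intro!: bexI[of _ 1])
  show "(-p, 0) \<in> D4" by (auto simp: D4_def intro!: bexI[of _ "-1"])
  show "(p, p) \<in> D4" by (auto simp: D4_def intro!: bexI[of _ 2])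
qed

lemma sroot_in_L: "sroot v \<in> L"
  by (cases v) (auto simp: L_def)

lemma sroot_is_root:
  assumes "v \<in> D"
  shows "is_root (sroot v)"
proof -
  have "nrm (sroot v) = 2"
  proof (cases v)
    case (Ne j k)
    with assms have "j \<noteq> k" by (auto simp: D_def)
    moreover from this have "j = 0 \<or> j = 1 \<or> j = 2 \<or> j = 3" "k = 0 \<or> k = 1 \<or> k = 2 \<or> k = 3"
      using all4[of "\<lambda>j. j = 0 \<or> j = 1 \<or> j = 2 \<or> j = 3"] by auto
    ultimately show ?thesis
      using Ne by (auto simp: nrm_def sum4' p_def)
  next
    case (Nc k)
    then show ?thesis
      using all4[of "\<lambda>k. nrm (sroot (Nc k)) = 2"] by (simp add: nrm_def sum4' p_def)
  next
    case (Ng k)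
    then show ?thesis
      using all4[of "\<lambda>k. nrm (sroot (Ng k)) = 2"] by (simp add: nrm_def sum4' p_def)
  next
    case (Nb k)
    then show ?thesis
      using all4[of "\<lambda>k. nrm (sroot (Nb k)) = 2"] by (simp add: nrm_def sum4' p_def)
  next
    case (Nd k)
    then show ?thesis
      using all4[of "\<lambda>k. nrm (sroot (Nd k)) = 2"] by (simp add: nrm_def sum4' p_def)
  next
    case (Nf k)
    then show ?thesis
      using all4[of "\<lambda>k. nrm (sroot (Nf k)) = 2"] by (simp add: nrm_def sum4' p_def)
  next
    case (Nh k)
    then show ?thesis
      using all4[of "\<lambda>k. nrm (sroot (Nh k)) = 2"] by (simp add: nrm_def sum4' p_def)
  qed (simp_all add: nrm_def p_def)
  then show ?thesis
    by (simp add: is_root_def sroot_in_L)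
qed

lemma card_D: "card D = 32"
proof -
  have U: "(UNIV :: 4 set) = {0, 1, 2, 3}"
    using all4[of "\<lambda>k. k \<in> {0, 1, 2, 3}"] by auto
  have "{Ne j k | j k. j < k} = {Ne 0 1, Ne 0 2, Ne 0 3, Ne 1 2, Ne 1 3, Ne 2 3}"
  proof -
    have lt: "(0::4) < 1" "(0::4) < 2" "(0::4) < 3" "(1::4) < 2" "(1::4) < 3" "(2::4) < 3"
      by (simp_all add: less_bit0_def bit0.Rep_0 bit0.Rep_1 bit0.Rep_numeral)
    then have "\<forall>j k. j < k \<longrightarrow> Ne j k \<in> {Ne 0 1, Ne 0 2, Ne 0 3, Ne 1 2, Ne 1 3, Ne 2 3}"
      unfolding all4 by (simp add: less_imp_not_less)
    with lt show ?thesis by blast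
  qed
  then show ?thesis
    unfolding D_def U by simp
qed

end

theory Submission
  imports Defs
begin

text \<open>
  All inner products of \<open>L\<close> lie in \<open>p \<int>[\<i>]\<close>, so a root \<open>r\<close> has two Gaussian integers as
  heights, \<open>\<langle>l\<^sub>\<infinity>|r\<rangle> = cnj p * a\<close> and \<open>\<langle>p\<^sub>\<infinity>|r\<rangle> = cnj p * b\<close>.  As \<open>tau\<close> is a combination of the two
  cusps, \<open>\<langle>r|tau\<rangle>\<close> depends on the heights alone (lemma \<open>herm_tau\<close>):
  \<open>|\<langle>r|tau\<rangle>|\<^sup>2 = 2 (|a|\<^sup>2 + |b|\<^sup>2 - sqrt 2 X)\<close> with \<open>X = Re (p a cnj b)\<close>.  The listed roots
  have heights \<open>(1, 0)\<close> or \<open>(0, \<i>)\<close>, hence the value 2, and it has to be shown that a root with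
  value at most 2 is a unit multiple of a listed one.

  The number \<open>X\<close> is the norm of the projection of \<open>r\<close> to the hyperbolic plane spanned by the cusps.
  The orthogonal complement of this plane is positive definite, so \<open>X \<le> 2\<close>; together with value at
  most 2 this leaves only finitely many heights.  If \<open>X\<close> were positive, then \<open>|a|\<^sup>2\<close> would be 1 or 2,
  so that \<open>a\<close> is not divisible by 2.  But the component of \<open>r\<close> in the complement has eight
  coordinates in \<open>\<plusminus> a / 2 + \<int>[\<i>]\<close>, each of squared modulus at least \<open>1 / 4\<close>; its norm \<open>2 - X\<close> is
  then at least 2, a contradiction.  So \<open>X \<le> 0\<close> and \<open>|a|\<^sup>2 + |b|\<^sup>2 \<le> 1\<close> (lemma \<open>heights_bound\<close>).

  Up to a unit, \<open>r\<close> is now orthogonal to one cusp and has height 1 or \<open>\<i>\<close> at the other, since no root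
  is orthogonal to both.  On the orthogonal complement of a cusp the form is a sum of eight squared
  moduli, and a short vector of norm 2 leaves very little choice: congruences modulo \<open>p\<close> within
  the four blocks bring it down to the 16 roots with labels \<open>Nb, Nd, Nf, Nh\<close> for \<open>l\<^sub>\<infinity>\<close> and the 16 with
  labels \<open>Na, Nc, Ne, Ng, Nz\<close> for \<open>p\<^sub>\<infinity>\<close>.

  The 32 mirrors are distinct because a mirror determines its root up to a scalar, the listed
  roots are distinct, and their heights rule out every scalar other than 1.
\<close>

section \<open>Gaussian integers\<close>

text \<open>
  The squared modulus as a natural number, so that parity and sums of norms can be treated in
  \<open>nat\<close>; on Gaussian integers the floor changes nothing.
\<close>

definition gnorm :: "complex \<Rightarrow> nat" where
  "gnorm z = nat \<lfloor>(cmod z)\<^sup>2\<rfloor>"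

lemma gaussian_cnj [simp]: "cnj z \<in> gaussian \<longleftrightarrow> z \<in> gaussian"
  by (simp add: gaussian_def)

lemma gaussian_sum [intro]: "(\<And>k. k \<in> K \<Longrightarrow> f k \<in> gaussian) \<Longrightarrow> sum f K \<in> gaussian"
  by (induction K rule: infinite_finite_induct) auto

lemma real_gnorm: "z \<in> gaussian \<Longrightarrow> real (gnorm z) = (cmod z)\<^sup>2"
proof -
  assume "z \<in> gaussian"
  then have "(Re z)\<^sup>2 + (Im z)\<^sup>2 \<in> \<int>" by (simp add: gaussian_def)
  then have "(cmod z)\<^sup>2 \<in> \<int>" by (simp add: cmod_power2)
  then show ?thesis by (auto simp: gnorm_def elim!: Ints_cases)
qed

lemma gnorm_eq_0: "z \<in> gaussian \<Longrightarrow> gnorm z = 0 \<longleftrightarrow> z = 0"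
  by (metis norm_eq_zero of_nat_0 of_nat_eq_0_iff power_eq_0_iff real_gnorm zero_neq_numeral
      norm_zero zero_power2)

lemma gnorm_mult: "z \<in> gaussian \<Longrightarrow> w \<in> gaussian \<Longrightarrow> gnorm (z * w) = gnorm z * gnorm w"
proof -
  assume "z \<in> gaussian" "w \<in> gaussian"
  then have "real (gnorm (z * w)) = real (gnorm z * gnorm w)"
    by (simp add: real_gnorm norm_mult power_mult_distrib)
  then show ?thesis by (simp only: of_nat_eq_iff)
qed

lemma gnorm_p [simp]: "gnorm p = 2"
  by (simp add: gnorm_def cmod_power2 p_def)

lemma gnorm_2 [simp]: "gnorm 2 = 4"
  by (simp add: gnorm_def)

lemma gnorm_1 [simp]: "gnorm 1 = 1"
  by (simp add: gnorm_def)

lemma gnorm_0 [simp]: "gnorm 0 = 0"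
  by (simp add: gnorm_def)

lemma gnorm_of_nat: "gnorm (of_nat c) = c * c"
  by (simp add: gnorm_def power2_eq_square flip: of_nat_mult)

lemma gnorm_minus [simp]: "gnorm (- z) = gnorm z"
  by (simp add: gnorm_def)

lemma gnorm_cnj [simp]: "gnorm (cnj z) = gnorm z"
  by (simp add: gnorm_def)

lemma gnorm_parallelogram:
  assumes "z \<in> gaussian" "w \<in> gaussian"
  shows "gnorm (z + w) + gnorm (z - w) = 2 * (gnorm z + gnorm w)"
proof -
  have "real (gnorm (z + w) + gnorm (z - w)) = real (2 * (gnorm z + gnorm w))"
    using assms by (simp add: real_gnorm cmod_power2) (simp add: power2_eq_square algebra_simps)
  then show ?thesis by (simp only: of_nat_eq_iff)
qed

lemma even_gnorm_add:
  assumes "z \<in> gaussian" "w \<in> gaussian"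
  shows "even (gnorm (z + w)) \<longleftrightarrow> even (gnorm z + gnorm w)"
proof -
  obtain a b c d :: int where zw: "Re z = a" "Im z = b" "Re w = c" "Im w = d"
    using assms by (auto simp: gaussian_def elim!: Ints_cases)
  have "real_of_int (int (gnorm (z + w))) = real_of_int (int (gnorm z + gnorm w) + 2 * (a*c + b*d))"
    using assms zw by (simp add: real_gnorm cmod_power2) (simp add: power2_eq_square algebra_simps)
  then have "int (gnorm (z + w)) = int (gnorm z + gnorm w) + 2 * (a*c + b*d)"
    by (simp only: of_int_eq_iff)
  then show ?thesis by presburger
qed

lemma even_gnorm_diff:
  assumes "z \<in> gaussian" "w \<in> gaussian"
  shows "even (gnorm (z - w)) \<longleftrightarrow> even (gnorm z + gnorm w)"
  using even_gnorm_add[of z "- w"] assms by simp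

lemma even_gnorm_iff_p_dvd:
  assumes "z \<in> gaussian"
  shows "even (gnorm z) \<longleftrightarrow> (\<exists>w\<in>gaussian. z = p * w)"
proof
  assume ev: "even (gnorm z)"
  obtain a b :: int where ab: "Re z = a" "Im z = b"
    using assms by (auto simp: gaussian_def elim!: Ints_cases)
  have "real_of_int (int (gnorm z)) = real_of_int (a*a + b*b)"
    using assms ab by (simp add: real_gnorm cmod_power2) (simp add: power2_eq_square)
  then have "int (gnorm z) = a*a + b*b" by (simp only: of_int_eq_iff)
  with ev have "even (a + b)" by (metis even_add even_mult_iff even_of_nat)
  then obtain c where c: "a + b = 2 * c" by (elim evenE)
  have "z = p * Complex c (b - c)"
  proof -
    have "real_of_int a + real_of_int b = 2 * real_of_int c"
      using c by (metis of_int_add of_int_mult of_int_numeral)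
    then show ?thesis using ab by (simp add: complex_eq_iff p_def algebra_simps)
  qed
  moreover have "Complex c (b - c) \<in> gaussian" by (simp add: gaussian_def)
  ultimately show "\<exists>w\<in>gaussian. z = p * w" by blast
qed (auto simp: gnorm_mult)

text \<open>
  The units congruent to 1 modulo 2 are \<open>1\<close> and \<open>-1\<close>.  This is where a choice of unit turns into
  a choice between two listed roots.
\<close>

lemma gnorm_twice_plus_one_eq_1D:
  assumes "z \<in> gaussian" "gnorm (2 * z + 1) = 1"
  shows "z = 0 \<or> z = -1"
proof -
  obtain a b :: int where zw: "Re z = a" "Im z = b"
    using assms by (auto simp: gaussian_def elim!: Ints_cases)
  have "real_of_int (int (gnorm (2 * z + 1))) = real_of_int ((2*a+1)^2 + (2*b)^2)"
    using assms(1) zw by (simp add: real_gnorm cmod_power2)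
  then have "1 = (2*a+1)^2 + (2*b)^2" using assms(2) by (simp only: of_int_eq_iff)
  then have "a * (a + 1) + b * b = 0" by (simp add: power2_eq_square algebra_simps)
  moreover have "a * (a + 1) \<ge> 0" by (cases "a \<ge> 0") (auto simp: zero_le_mult_iff)
  moreover have "b * b \<ge> 0" by simp
  ultimately have "a * (a + 1) = 0" "b * b = 0" by linarith+
  then show ?thesis using zw by (auto simp: complex_eq_iff)
qed

lemma p_neq_0: "p \<noteq> 0" "cnj p \<noteq> 0"
  by (simp_all add: p_def complex_eq_iff)

lemma cnj_p_times_i: "cnj p * \<i> = p"
  by (simp add: p_def complex_eq_iff)

section \<open>Sums of natural numbers\<close>

lemma sum_two_even:
  fixes f :: "'a::finite \<Rightarrow> nat"
  assumes "sum f UNIV = 2" "\<And>k. even (f k)"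
  obtains k where "f k = 2" "\<And>i. i \<noteq> k \<Longrightarrow> f i = 0"
proof -
  obtain k where k: "f k \<noteq> 0" using assms(1) by (metis sum.neutral zero_neq_numeral)
  have "sum f UNIV = f k + sum f (UNIV - {k})" by (simp add: sum.remove)
  moreover have "f k \<ge> 2" using k assms(2)[of k] by (auto elim!: evenE)
  ultimately have "f k = 2" "sum f (UNIV - {k}) = 0" using assms(1) by linarith+
  then show ?thesis using that[of k] by simp
qed

lemma sum_const_bound_eq:
  fixes f :: "'a::finite \<Rightarrow> nat"
  assumes "\<And>k. c \<le> f k" "sum f UNIV = CARD('a) * c"
  shows "f k = c"
proof -
  have "(\<Sum>k\<in>UNIV. f k - c) = 0"
    using assms by (subst sum_subtractf_nat) auto
  then show ?thesis using assms(1)[of k] by (simp add: antisym)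
qed

section \<open>The form in coordinates\<close>

lemma herm_add_left: "herm (u + v) w = herm u w + herm v w"
  by (cases u; cases v; cases w) (simp add: algebra_simps sum.distrib)

lemma herm_add_right: "herm w (u + v) = herm w u + herm w v"
  by (cases u; cases v; cases w) (simp add: algebra_simps sum.distrib)

lemma herm_cscale_right: "herm w (cscale c v) = c * herm w v"
  by (cases v; cases w) (simp add: algebra_simps sum_distrib_left)

lemma herm_cscale_left: "herm (cscale c v) w = cnj c * herm v w"
  by (metis complex_cnj_mult herm_cnj herm_cscale_right)

lemma herm_diff_left: "herm (u - v) w = herm u w - herm v w"
  by (metis add_diff_cancel_right' diff_add_cancel herm_add_left)

lemma nrm_coords:
  "nrm (x, m, n) = (\<Sum>k\<in>UNIV. (cmod (fst (x $ k)))\<^sup>2 + (cmod (snd (x $ k)))\<^sup>2)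
     + 2 * Re (p * m * cnj n)"
  unfolding nrm_def
  by (simp add: cmod_power2) (simp add: power2_eq_square algebra_simps sum.distrib)

lemma D4_gaussian: "y \<in> D4 \<Longrightarrow> fst y \<in> gaussian \<and> snd y \<in> gaussian"
  by (auto simp: D4_def)

lemma D4_even: "y \<in> D4 \<Longrightarrow> even (gnorm (fst y) + gnorm (snd y))"
  by (auto simp: D4_def gnorm_mult even_gnorm_add[symmetric] simp del: even_add)

text \<open>
  Within a block, \<open>x\<^sub>1 \<equiv> x\<^sub>2\<close> and \<open>x\<^sub>1' \<equiv> x\<^sub>2'\<close> modulo \<open>p\<close>, so the two products have sum
  \<open>0\<close> in the field \<open>\<int>[\<i>] / p\<close> of two elements.  The quotient by \<open>cnj p\<close> is as good as the one by
  \<open>p\<close>, the two primes being associated.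
\<close>

lemma herm_L_p_dvd:
  assumes "v \<in> L" "w \<in> L"
  shows "herm v w / cnj p \<in> gaussian"
proof -
  have blk: "\<exists>g\<in>gaussian. cnj (fst y) * fst y' + cnj (snd y) * snd y' = p * g"
    if "y \<in> D4" "y' \<in> D4" for y y'
    using that D4_even[OF that(1)] D4_even[OF that(2)] D4_gaussian[of y] D4_gaussian[of y']
    by (subst even_gnorm_iff_p_dvd[symmetric])
       (auto simp: even_gnorm_add gnorm_mult)
  obtain x m n x' m' n' where vw: "v = (x, m, n)" "w = (x', m', n')"
    by (cases v; cases w) auto
  have "\<forall>k. \<exists>g. g \<in> gaussian \<and>
      cnj (fst (x $ k)) * fst (x' $ k) + cnj (snd (x $ k)) * snd (x' $ k) = p * g"
    using assms vw blk unfolding L_def by blast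
  then obtain g where g: "\<And>k. g k \<in> gaussian"
    "\<And>k. cnj (fst (x $ k)) * fst (x' $ k) + cnj (snd (x $ k)) * snd (x' $ k) = p * g k"
    by metis
  have "herm v w = (\<Sum>k\<in>UNIV. p * g k) + (cnj m * cnj p * n' + cnj n * p * m')"
    unfolding vw herm.simps g(2) ..
  also have "\<dots> = cnj p * (\<i> * (\<Sum>k\<in>UNIV. g k) + cnj m * n' + \<i> * (cnj n * m'))"
    unfolding sum_distrib_left[symmetric] by (subst (1 2) cnj_p_times_i[symmetric]) (simp add: algebra_simps)
  finally have "herm v w / cnj p = \<i> * (\<Sum>k\<in>UNIV. g k) + cnj m * n' + \<i> * (cnj n * m')"
    using p_neq_0 by simp
  also have "\<dots> \<in> gaussian"
    using assms vw g(1) gaussian_sum[of UNIV g] by (auto simp: L_def intro!: gaussian_closed)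
  finally show ?thesis .
qed

lemma herm_l_inf:
  "herm l_inf (x, m, n) = cnj p * ((\<Sum>k\<in>UNIV. snd (x $ k)) - (2 + \<i>) * n + p * m)"
  by (simp add: l_inf_eq algebra_simps sum_distrib_left p_def)

lemma herm_p_inf:
  "herm p_inf (x, m, n)
     = - ((\<Sum>k\<in>UNIV. fst (x $ k)) + (\<Sum>k\<in>UNIV. snd (x $ k)) - 2 * p * n + 2 * p * m)"
  by (simp add: p_inf_eq algebra_simps sum.distrib sum_negf sum_subtractf p_def)

lemma sum_shifted_norm:
  fixes f :: "'a::finite \<Rightarrow> complex"
  shows "(\<Sum>k\<in>UNIV. (cmod (f k + d))\<^sup>2) = (\<Sum>k\<in>UNIV. (cmod (f k))\<^sup>2)
    + 2 * Re ((\<Sum>k\<in>UNIV. f k) * cnj d) + real CARD('a) * (cmod d)\<^sup>2"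
proof -
  have "(cmod (f k + d))\<^sup>2 = (cmod (f k))\<^sup>2 + 2 * Re (f k * cnj d) + (cmod d)\<^sup>2" for k
    by (simp add: cmod_power2) (simp add: power2_eq_square algebra_simps)
  then show ?thesis
    by (simp add: sum.distrib sum_distrib_left sum_distrib_right)
qed

section \<open>Lattice vectors measured against the two cusps\<close>

text \<open>
  The heights \<open>a\<close> and \<open>b\<close> of a lattice vector at the two cusps.  Either one determines \<open>m\<close>
  from the other coordinates, which is how the hyperbolic summand is eliminated from the norm.
\<close>

locale cusp_heights =
  fixes x :: "(complex \<times> complex)^4" and m n a b :: complex
  assumes in_L: "(x, m, n) \<in> L"
    and height_l: "herm l_inf (x, m, n) = cnj p * a"
    and height_p: "herm p_inf (x, m, n) = cnj p * b"
begin

lemma coord_gaussian: "fst (x $ k) \<in> gaussian" "snd (x $ k) \<in> gaussian" "m \<in> gaussian" "n \<in> gaussian"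
  using in_L D4_gaussian by (auto simp: L_def)

lemma block_even: "even (gnorm (fst (x $ k)) + gnorm (snd (x $ k)))"
  using in_L D4_even by (auto simp: L_def)

lemma gaussian_a: "a \<in> gaussian" and gaussian_b: "b \<in> gaussian"
proof -
  have "l_inf \<in> L" "p_inf \<in> L"
    by (auto simp: l_inf_eq p_inf_eq L_def)
  then show "a \<in> gaussian" "b \<in> gaussian"
    using herm_L_p_dvd[OF _ in_L] height_l height_p p_neq_0 by (metis nonzero_mult_div_cancel_left)+
qed

lemma pm_eq: "p * m = a - (\<Sum>k\<in>UNIV. snd (x $ k) - n) - (2 - \<i>) * n"
proof -
  have "a = (\<Sum>k\<in>UNIV. snd (x $ k)) - (2 + \<i>) * n + p * m"
    using height_l p_neq_0 by (simp add: herm_l_inf)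
  then show ?thesis by (simp add: sum_subtractf algebra_simps)
qed

lemma two_pm_eq:
  "2 * p * m = 2 * p * n - (\<Sum>k\<in>UNIV. fst (x $ k)) - (\<Sum>k\<in>UNIV. snd (x $ k)) - cnj p * b"
  using height_p by (simp add: herm_p_inf algebra_simps)

text \<open>
  Equating the two expressions for \<open>p * m\<close> leaves a linear relation that ties the heights to \<open>x\<close>
  and \<open>n\<close> alone.
\<close>

lemma column_difference:
  "(\<Sum>k\<in>UNIV. fst (x $ k)) - (\<Sum>k\<in>UNIV. snd (x $ k) - n) = 2 * n - 2 * a - cnj p * b"
proof -
  have "2 * (p * m) = 2 * p * n - (\<Sum>k\<in>UNIV. fst (x $ k)) - (\<Sum>k\<in>UNIV. snd (x $ k)) - cnj p * b"
    using two_pm_eq by (simp add: mult.assoc)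
  then show ?thesis
    unfolding pm_eq by (simp add: sum_subtractf p_def algebra_simps)
qed

text \<open>
  For \<open>a = 0\<close> this exhibits the form on the orthogonal complement of \<open>l\<^sub>\<infinity>\<close> as a sum of squares.
  Its coordinates \<open>x\<^sub>k\<^sub>1\<close> and \<open>x\<^sub>k\<^sub>2 - n\<close> vanish on \<open>l\<^sub>\<infinity>\<close>, which spans the radical of
  the restricted form.
\<close>

lemma nrm_at_l:
  "nrm (x, m, n) = (\<Sum>k\<in>UNIV. (cmod (fst (x $ k)))\<^sup>2) + (\<Sum>k\<in>UNIV. (cmod (snd (x $ k) - n))\<^sup>2)
     + 2 * Re (a * cnj n)"
proof -
  define B where "B k = snd (x $ k) - n" for k
  have B: "snd (x $ k) = B k + n" for k by (simp add: B_def)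
  show ?thesis
    unfolding nrm_coords pm_eq sum.distrib unfolding B sum_shifted_norm
    by (simp add: cmod_power2) (simp add: power2_eq_square algebra_simps)
qed

text \<open>
  Likewise \<open>x\<^sub>k\<^sub>1 - n / 2\<close> and \<open>x\<^sub>k\<^sub>2 - n / 2\<close> are coordinates on the orthogonal complement of
  \<open>p\<^sub>\<infinity>\<close> modulo \<open>p\<^sub>\<infinity>\<close>; doubling them keeps everything in the Gaussian integers.
\<close>

lemma nrm_at_p:
  assumes "b = 0"
  shows "4 * nrm (x, m, n) = (\<Sum>k\<in>UNIV. (cmod (2 * fst (x $ k) - n))\<^sup>2 + (cmod (2 * snd (x $ k) - n))\<^sup>2)"
proof -
  have *: "2 * Re (p * m * cnj n) = Re ((2 * p * m) * cnj n)" by (simp add: algebra_simps)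
  show ?thesis
  unfolding nrm_coords * two_pm_eq assms diff_conv_add_uminus[of "2 * _" n] sum.distrib
    sum_shifted_norm sum_distrib_left[symmetric]
  by (simp add: sum.distrib cmod_power2 norm_mult power_mult_distrib sum_distrib_left[symmetric])
     (simp add: power2_eq_square algebra_simps p_def)
qed

text \<open>
  Both sides are four times the norm of the component of the vector orthogonal to both cusps: on
  the right as the norm minus that of the projection to their span, on the left as the sum of
  squares that \<open>nrm_at_l\<close> gives for this component.
\<close>

lemma nrm_at_both:
  "(\<Sum>k\<in>UNIV. (cmod (2 * fst (x $ k) + a))\<^sup>2 + (cmod (2 * (snd (x $ k) - n) - a))\<^sup>2)
     = 4 * nrm (x, m, n) - 4 * Re (p * a * cnj b)"
proof -
  let ?A = "\<Sum>k\<in>UNIV. fst (x $ k)" and ?B = "\<Sum>k\<in>UNIV. snd (x $ k) - n"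
  have A: "?A = ?B + (2 * n - 2 * a - cnj p * b)"
    using column_difference by (simp add: algebra_simps)
  show ?thesis
    unfolding nrm_at_l diff_conv_add_uminus[of "2 * _" a] sum.distrib
      sum_shifted_norm sum_distrib_left[symmetric] A
    unfolding norm_mult power_mult_distrib sum_distrib_left[symmetric]
    by (simp add: cmod_power2) (simp add: power2_eq_square algebra_simps)
qed

text \<open>
  The second hypothesis says that \<open>|\<langle>r|tau\<rangle>|\<^sup>2 \<le> 2\<close>.  Positivity of \<open>nrm_at_both\<close> bounds the cross term
  \<open>X = Re (p * a * cnj b)\<close> by 2.  If \<open>X\<close> were positive, this bound would make 2 not divide \<open>a\<close>, and each of the eight
  summands would be at least 1.
\<close>

lemma heights_bound:
  assumes root: "nrm (x, m, n) = 2"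
    and near: "(cmod a)\<^sup>2 + (cmod b)\<^sup>2 - sqrt 2 * Re (p * a * cnj b) \<le> 1"
  shows "gnorm a + gnorm b \<le> 1"
proof -
  define X where "X = Re (p * a * cnj b)"
  have sum: "(\<Sum>k\<in>UNIV. (cmod (2 * fst (x $ k) + a))\<^sup>2 + (cmod (2 * (snd (x $ k) - n) - a))\<^sup>2) = 8 - 4 * X"
    unfolding nrm_at_both root X_def by simp
  have "8 - 4 * X \<ge> 0" unfolding sum[symmetric] by (intro sum_nonneg) auto
  then have X2: "X \<le> 2" by simp
  have near': "real (gnorm a + gnorm b) \<le> 1 + sqrt 2 * X"
    using near by (simp add: X_def real_gnorm gaussian_a gaussian_b)
  have "X \<le> 0"
  proof (rule ccontr)
    assume "\<not> X \<le> 0"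
    have "sqrt 2 < 3 / 2" by (rule real_less_lsqrt) (auto simp: power2_eq_square)
    moreover have "sqrt 2 * X \<le> sqrt 2 * 2" using X2 by (intro mult_left_mono) auto
    ultimately have "real (gnorm a + gnorm b) < 4" using near' by linarith
    then have "gnorm a + gnorm b < 4" by linarith
    moreover have "a \<noteq> 0" "b \<noteq> 0" using \<open>\<not> X \<le> 0\<close> by (auto simp: X_def)
    ultimately have a12: "gnorm a \<in> {1, 2}"
      using gnorm_eq_0[OF gaussian_a] gnorm_eq_0[OF gaussian_b] by auto
    \<comment> \<open>\<open>2 * g + c = 0\<close> would make \<open>gnorm a\<close> divisible by 4.\<close>
    have ge1: "1 \<le> (cmod (2 * g + c))\<^sup>2" if "g \<in> gaussian" "c = a \<or> c = - a" for g c
    proof -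
      have G: "2 * g + c \<in> gaussian" using that gaussian_a by auto
      have "2 * g + c \<noteq> 0"
      proof
        assume "2 * g + c = 0"
        then have "c = - (2 * g)" by (simp add: add_eq_0_iff2)
        then have "gnorm a = gnorm (2 * g)" using that(2) by (metis gnorm_minus)
        with a12 that(1) show False by (auto simp: gnorm_mult)
      qed
      then have "gnorm (2 * g + c) \<ge> 1" using gnorm_eq_0[OF G] by simp
      then show ?thesis using real_gnorm[OF G] by (metis of_nat_1 of_nat_mono)
    qed
    have "(\<Sum>k\<in>(UNIV::4 set). 1 + 1) \<le>
        (\<Sum>k\<in>UNIV. (cmod (2 * fst (x $ k) + a))\<^sup>2 + (cmod (2 * (snd (x $ k) - n) - a))\<^sup>2)"
      unfolding diff_conv_add_uminus[of "2 * _" a]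
      using coord_gaussian by (intro sum_mono add_mono ge1) auto
    then show False using sum \<open>\<not> X \<le> 0\<close> by simp
  qed
  then have "sqrt 2 * X \<le> 0" by (simp add: mult_nonneg_nonpos)
  then show ?thesis using near' by linarith
qed

section \<open>Roots orthogonal to \<open>l_inf\<close>\<close>

text \<open>
  The norms of the four blocks, measured in the coordinates of \<open>nrm_at_l\<close>, add up to 2 and are all
  congruent to \<open>gnorm n\<close> modulo 2.  If they were odd their sum would be at least 4; so they are even
  and a single block carries the whole norm.  In that block a pair of units would fit the norm, but
  not the requirement that \<open>m\<close> be a Gaussian integer.
\<close>

lemma single_block_if_orthogonal_to_l_inf:
  assumes root: "nrm (x, m, n) = 2" and "a = 0"
  obtains k \<nu> where "\<nu> \<in> gaussian" "n = p * \<nu>"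
    "\<forall>i. i \<noteq> k \<longrightarrow> x $ i = (0, n)"
    "fst (x $ k) = 0 \<and> gnorm (snd (x $ k) - n) = 2 \<or> gnorm (fst (x $ k)) = 2 \<and> snd (x $ k) = n"
proof -
  define B where "B = (\<lambda>k. snd (x $ k) - n)"
  have BG: "B k \<in> gaussian" for k using coord_gaussian by (simp add: B_def)
  define f where "f k = gnorm (fst (x $ k)) + gnorm (B k)" for k
  have "real (sum f UNIV) = real 2"
    using nrm_at_l root \<open>a = 0\<close> BG coord_gaussian
    by (simp add: f_def real_gnorm sum.distrib) (simp add: B_def)
  then have sumf: "sum f UNIV = 2" by (simp only: of_nat_eq_iff)
  have par: "even (f k) \<longleftrightarrow> even (gnorm n)" for k
    using block_even[of k] coord_gaussian by (auto simp: f_def B_def even_gnorm_diff)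
  have evn: "even (gnorm n)"
  proof (rule ccontr)
    assume "odd (gnorm n)"
    then have "1 \<le> f k" for k using par[of k] by (cases "f k") auto
    then have "(\<Sum>k\<in>(UNIV::4 set). 1) \<le> sum f UNIV" by (intro sum_mono)
    then show False using sumf by simp
  qed
  with par sumf obtain k where k: "f k = 2" "\<And>i. i \<noteq> k \<Longrightarrow> f i = 0"
    using sum_two_even by metis
  have rest: "fst (x $ i) = 0 \<and> B i = 0" if "i \<noteq> k" for i
    using k(2)[OF that] BG coord_gaussian by (simp add: f_def gnorm_eq_0)
  have "p * m = a - sum B UNIV - (2 - \<i>) * n"
    using pm_eq by (simp only: B_def)
  moreover have "sum B UNIV = B k"
    using rest by (subst sum.remove[of _ k]) auto
  ultimately have "B k = - (p * m + (2 - \<i>) * n)"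
    using \<open>a = 0\<close> by (simp add: algebra_simps)
  \<comment> \<open>Integrality of \<open>m\<close> forces \<open>p\<close> to divide \<open>B k\<close>, which excludes a pair of units.\<close>
  then have "gnorm (B k) = gnorm (p * m + (2 - \<i>) * n)" by (simp only: gnorm_minus)
  then have "even (gnorm (B k))"
    using evn coord_gaussian by (auto simp: even_gnorm_add gnorm_mult)
  then have "gnorm (B k) = 0 \<or> gnorm (B k) = 2"
    using k(1) unfolding f_def by presburger
  then have "fst (x $ k) = 0 \<and> gnorm (B k) = 2 \<or> gnorm (fst (x $ k)) = 2 \<and> B k = 0"
    using k(1) BG[of k] coord_gaussian(1)[of k] by (auto simp: f_def gnorm_eq_0)
  moreover obtain \<nu> where "\<nu> \<in> gaussian" "n = p * \<nu>"
    using evn even_gnorm_iff_p_dvd coord_gaussian by auto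
  ultimately show ?thesis
    using that[of \<nu> k] rest by (auto simp: B_def prod_eq_iff)
qed

lemma column_difference_one_block:
  assumes "a = 0" "\<forall>i. i \<noteq> k \<longrightarrow> x $ i = (0, n)"
  shows "fst (x $ k) - (snd (x $ k) - n) = 2 * n - cnj p * b"
    and "p * m = - (snd (x $ k) - n) - (2 - \<i>) * n"
proof -
  have "(\<Sum>k\<in>UNIV. fst (x $ k)) = fst (x $ k)" "(\<Sum>k\<in>UNIV. snd (x $ k) - n) = snd (x $ k) - n"
    using assms(2) by (subst sum.remove[of _ k]; auto)+
  then show "fst (x $ k) - (snd (x $ k) - n) = 2 * n - cnj p * b"
    and "p * m = - (snd (x $ k) - n) - (2 - \<i>) * n"
    using column_difference pm_eq assms(1) by simp_all
qed

text \<open>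
  The only nonzero coordinate of such a root would have norm 2 and at the same time be \<open>\<plusminus> 2 * n\<close>, whose
  norm is divisible by 8.
\<close>

lemma no_root_orthogonal_to_both_cusps:
  assumes "nrm (x, m, n) = 2" "a = 0"
  shows "b \<noteq> 0"
proof
  assume "b = 0"
  obtain k \<nu> where k: "\<nu> \<in> gaussian" "n = p * \<nu>"
    "\<forall>i. i \<noteq> k \<longrightarrow> x $ i = (0, n)"
    "fst (x $ k) = 0 \<and> gnorm (snd (x $ k) - n) = 2 \<or> gnorm (fst (x $ k)) = 2 \<and> snd (x $ k) = n"
    using single_block_if_orthogonal_to_l_inf[OF assms] by blast
  have "gnorm (fst (x $ k) - (snd (x $ k) - n)) = 2"
    using k(4) by (auto simp: gnorm_def norm_minus_commute)
  moreover have "fst (x $ k) - (snd (x $ k) - n) = 2 * (p * \<nu>)"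
    using column_difference_one_block(1)[OF assms(2) k(3)] \<open>b = 0\<close> k(2) by simp
  ultimately have "gnorm (2 * (p * \<nu>)) = 2" by (simp only:)
  then show False using k(1) by (simp add: gnorm_mult)
qed

text \<open>
  The height \<open>b = \<i>\<close> requires the nonzero coordinate to be \<open>\<plusminus> p\<close> times the unit \<open>1 - 2 * \<nu>\<close>.  So \<open>\<nu>\<close> is 0
  or 1, and it can be in either place of its block: four roots for each of the four blocks.
\<close>

lemma roots_orthogonal_to_l_inf:
  assumes "nrm (x, m, n) = 2" "a = 0" "b = \<i>"
  shows "\<exists>v\<in>D. (x, m, n) = sroot v"
proof -
  obtain k \<nu> where k: "\<nu> \<in> gaussian" "n = p * \<nu>"
    "\<forall>i. i \<noteq> k \<longrightarrow> x $ i = (0, n)"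
    "fst (x $ k) = 0 \<and> gnorm (snd (x $ k) - n) = 2 \<or> gnorm (fst (x $ k)) = 2 \<and> snd (x $ k) = n"
    using single_block_if_orthogonal_to_l_inf[OF assms(1,2)] by blast
  note diff = column_difference_one_block[OF assms(2) k(3)]
  have diff1: "fst (x $ k) - (snd (x $ k) - n) = - (p * (2 * (- \<nu>) + 1))"
    using diff(1) k(2) cnj_p_times_i assms(3) by (simp add: algebra_simps)
  have "gnorm (fst (x $ k) - (snd (x $ k) - n)) = 2"
    using k(4) by (auto simp: gnorm_def norm_minus_commute)
  then have "gnorm (2 * (- \<nu>) + 1) = 1"
    using diff1 k(1) by (simp add: gnorm_mult del: mult_minus_right)
  then have "\<nu> = 0 \<or> \<nu> = 1"
    using gnorm_twice_plus_one_eq_1D[of "- \<nu>"] k(1) by (auto simp: minus_equation_iff)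
  then consider "\<nu> = 0" "fst (x $ k) = 0" "snd (x $ k) = p" | "\<nu> = 0" "fst (x $ k) = - p" "snd (x $ k) = 0"
    | "\<nu> = 1" "fst (x $ k) = 0" "snd (x $ k) = 0" | "\<nu> = 1" "fst (x $ k) = p" "snd (x $ k) = p"
    using diff1 k(2,4) by fastforce
  then show ?thesis
  proof cases
    case 1
    then have "p * m = p * - 1" using diff(2) k(2) by simp
    then have "m = - 1" using p_neq_0 unfolding mult_cancel_left by blast
    then have "(x, m, n) = sroot (Nb k)"
      using 1 k(2,3) p_neq_0 by (auto simp: vec_eq_iff prod_eq_iff)
    moreover have "Nb k \<in> D" by (simp add: D_def)
    ultimately show ?thesis by blast
  next
    case 2
    then have "p * m = p * 0" using diff(2) k(2) by simp
    then have "m = 0" using p_neq_0 unfolding mult_cancel_left by blast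
    then have "(x, m, n) = sroot (Nd k)"
      using 2 k(2,3) p_neq_0 by (auto simp: vec_eq_iff prod_eq_iff)
    moreover have "Nd k \<in> D" by (simp add: D_def)
    ultimately show ?thesis by blast
  next
    case 3
    then have "p * m = p * (\<i> * p)" using diff(2) k(2) by (simp add: p_def algebra_simps)
    then have "m = \<i> * p" using p_neq_0 unfolding mult_cancel_left by blast
    then have "(x, m, n) = sroot (Nf k)"
      using 3 k(2,3) p_neq_0 by (auto simp: vec_eq_iff prod_eq_iff)
    moreover have "Nf k \<in> D" by (simp add: D_def)
    ultimately show ?thesis by blast
  next
    case 4
    then have "p * m = p * (p - 3)" using diff(2) k(2) by (simp add: p_def algebra_simps)
    then have "m = p - 3" using p_neq_0 unfolding mult_cancel_left by blast
    then have "(x, m, n) = sroot (Nh k)"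
      using 4 k(2,3) p_neq_0 by (auto simp: vec_eq_iff prod_eq_iff)
    moreover have "Nh k \<in> D" by (simp add: D_def)
    ultimately show ?thesis by blast
  qed
qed

section \<open>Roots orthogonal to \<open>p_inf\<close>\<close>

text \<open>
  When 2 does not divide \<open>n\<close>, none of the eight Gaussian integers \<open>2 * x\<^sub>k\<^sub>j - n\<close> vanishes, so their
  norms, which add up to 8, are all 1.  In particular \<open>gnorm n\<close> is odd.  By the congruence defining
  \<open>D4\<close>, the two units of a block have a nonzero sum divisible by 2, so they are equal.
\<close>

lemma odd_level_blocks:
  assumes root: "nrm (x, m, n) = 2" and "b = 0" and n: "\<nexists>\<nu>. \<nu> \<in> gaussian \<and> n = 2 * \<nu>"
  shows "fst (x $ k) = snd (x $ k)" "gnorm (2 * fst (x $ k) - n) = 1"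
proof -
  let ?y = "\<lambda>k. 2 * fst (x $ k) - n" and ?y' = "\<lambda>k. 2 * snd (x $ k) - n"
  have G: "?y k \<in> gaussian" "?y' k \<in> gaussian" for k using coord_gaussian by auto
  define f where "f k = gnorm (?y k) + gnorm (?y' k)" for k
  have "?y k \<noteq> 0" "?y' k \<noteq> 0" for k using n coord_gaussian by force+
  then have ge: "gnorm (?y k) \<ge> 1" "gnorm (?y' k) \<ge> 1" for k
    using gnorm_eq_0[OF G(1)] gnorm_eq_0[OF G(2)] by (simp_all add: Suc_le_eq)
  have "real (sum f UNIV) = real (CARD(4) * 2)"
    using nrm_at_p[OF \<open>b = 0\<close>] root G by (simp add: f_def real_gnorm)
  then have "sum f UNIV = CARD(4) * 2" by (simp only: of_nat_eq_iff)
  moreover have "2 \<le> f k" for k using ge[of k] by (simp add: f_def)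
  ultimately have "f k = 2" using sum_const_bound_eq[of 2 f k] by blast
  then have one: "gnorm (?y k) = 1" "gnorm (?y' k) = 1" using ge[of k] by (simp_all add: f_def)
  then show "gnorm (?y k) = 1" by simp
  let ?s = "fst (x $ k) + snd (x $ k) - n"
  have S: "?s \<in> gaussian" using coord_gaussian by auto
  have "odd (gnorm n)"
    using one(1) coord_gaussian even_gnorm_diff[of "2 * fst (x $ k)" n] by (simp add: gnorm_mult)
  then have "odd (gnorm ?s)"
    using block_even[of k] coord_gaussian by (simp add: even_gnorm_diff even_gnorm_add)
  then have s1: "gnorm ?s \<ge> 1" by (cases "gnorm ?s") auto
  have "gnorm (2 * ?s) = 4 * gnorm ?s" using S by (subst gnorm_mult) auto
  moreover have ys: "?y k + ?y' k = 2 * ?s" by (simp add: algebra_simps)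
  ultimately have "gnorm (?y k + ?y' k) \<ge> 4" unfolding ys using s1 by linarith
  then have "gnorm (?y k - ?y' k) = 0"
    using gnorm_parallelogram[OF G[of k]] unfolding one by simp
  then have "?y k - ?y' k = 0" using gnorm_eq_0 G by blast
  then show "fst (x $ k) = snd (x $ k)" by simp
qed

text \<open>
  With \<open>n = 2 * \<nu>\<close> the vectors \<open>x\<^sub>k - (\<nu>, \<nu>)\<close> lie in \<open>D4\<close> and their norms add up to 2, so one
  block carries everything.  The height \<open>a = 1\<close> fixes the difference of its entries as
  \<open>2 * (2 * \<nu> + 1)\<close>, of norm at least 4; by the parallelogram law the entries are opposite units.
\<close>

lemma roots_orthogonal_to_p_inf_even:
  assumes root: "nrm (x, m, n) = 2" and ab: "a = 1" "b = 0"
    and \<nu>: "\<nu> \<in> gaussian" "n = 2 * \<nu>"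
  shows "\<exists>v\<in>D. (x, m, n) = sroot v"
proof -
  let ?z = "\<lambda>k. fst (x $ k) - \<nu>" and ?z' = "\<lambda>k. snd (x $ k) - \<nu>"
  have G: "?z k \<in> gaussian" "?z' k \<in> gaussian" for k using coord_gaussian \<nu> by auto
  define f where "f k = gnorm (?z k) + gnorm (?z' k)" for k
  have four: "(cmod (2 * w - n))\<^sup>2 = 4 * (cmod (w - \<nu>))\<^sup>2" for w
    unfolding \<nu>(2) right_diff_distrib[symmetric] by (simp only: norm_mult power_mult_distrib) simp
  have "real (sum f UNIV) = real 2"
    using nrm_at_p[OF ab(2)] root G unfolding four
    by (simp add: f_def real_gnorm sum.distrib sum_distrib_left[symmetric])
  then have "sum f UNIV = 2" by (simp only: of_nat_eq_iff)
  moreover have "even (f k)" for k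
    using block_even[of k] coord_gaussian \<nu>(1) by (auto simp: f_def even_gnorm_diff)
  ultimately obtain k where k: "f k = 2" "\<And>i. i \<noteq> k \<Longrightarrow> f i = 0"
    using sum_two_even by metis
  have rest: "x $ i = (\<nu>, \<nu>)" if "i \<noteq> k" for i
    using k(2)[OF that] gnorm_eq_0 G by (auto simp: f_def prod_eq_iff)
  have "(\<Sum>k\<in>UNIV. snd (x $ k) - fst (x $ k)) = snd (x $ k) - fst (x $ k)"
    using rest by (subst sum.remove[of _ k]) auto
  moreover have "(\<Sum>k\<in>UNIV. snd (x $ k) - fst (x $ k)) = 2 * n + 2"
    using column_difference ab by (simp add: sum_subtractf algebra_simps)
  ultimately have d: "?z' k - ?z k = 2 * (2 * \<nu> + 1)" by (simp add: \<nu>)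
  have "gnorm (?z' k + ?z k) + 4 * gnorm (2 * \<nu> + 1) = 4"
  proof -
    have "gnorm (2 * (2 * \<nu> + 1)) = 4 * gnorm (2 * \<nu> + 1)"
      using \<nu>(1) by (subst gnorm_mult) auto
    then show ?thesis
      using gnorm_parallelogram[OF G(2,1), of k k] k(1) unfolding d by (simp add: f_def)
  qed
  moreover have "gnorm (2 * \<nu> + 1) \<noteq> 0"
  proof
    assume "gnorm (2 * \<nu> + 1) = 0"
    then have "2 * \<nu> + 1 = 0" using gnorm_eq_0 \<nu>(1) by auto
    then have "2 * \<nu> = - 1" by (simp add: eq_neg_iff_add_eq_0)
    then have "gnorm (2 * \<nu>) = 1" by (simp only: gnorm_minus gnorm_1)
    then show False using \<nu>(1) by (simp add: gnorm_mult)
  qed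
  ultimately have "gnorm (?z' k + ?z k) = 0" "gnorm (2 * \<nu> + 1) = 1" by linarith+
  then have "?z' k + ?z k = 0" and \<nu>01: "\<nu> = 0 \<or> \<nu> = -1"
    using gnorm_eq_0[OF gaussian_closed(1), OF G(2,1)] gnorm_twice_plus_one_eq_1D[OF \<nu>(1)] by blast+
  \<comment> \<open>The entries are \<open>\<nu> - u\<close> and \<open>\<nu> + u\<close> with \<open>u = 2 * \<nu> + 1\<close>.\<close>
  then have k_block: "x $ k = (- \<nu> - 1, 3 * \<nu> + 1)"
    using d by (auto simp: prod_eq_iff algebra_simps complex_eq_iff)
  have "(\<Sum>k\<in>UNIV. snd (x $ k) - n) = snd (x $ k) - n + (\<Sum>i\<in>UNIV - {k}. - \<nu>)"
    using rest by (subst sum.remove[of _ k]) (auto simp: \<nu>)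
  then have B: "(\<Sum>k\<in>UNIV. snd (x $ k) - n) = 1 - 2 * \<nu>"
    by (simp add: k_block \<nu> card_Diff_singleton)
  have "p * m = p * (2 * \<i> * \<nu>)"
    unfolding pm_eq B using \<nu>(2) ab by (simp add: p_def algebra_simps)
  then have m: "m = 2 * \<i> * \<nu>" using p_neq_0 unfolding mult_cancel_left by blast
  from \<nu>01 show ?thesis
  proof
    assume "\<nu> = 0"
    then have "(x, m, n) = sroot (Nc k)"
      using m \<nu>(2) k_block rest by (auto simp: vec_eq_iff)
    moreover have "Nc k \<in> D" by (simp add: D_def)
    ultimately show ?thesis by blast
  next
    assume "\<nu> = -1"
    then have "(x, m, n) = sroot (Ng k)"
      using m \<nu>(2) k_block rest by (auto simp: vec_eq_iff)
    moreover have "Ng k \<in> D" by (simp add: D_def)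
    ultimately show ?thesis by blast
  qed
qed

text \<open>
  The columns agree by \<open>odd_level_blocks\<close>, so the height \<open>a = 1\<close> forces \<open>n = -1\<close>, and every block is
  \<open>(0, 0)\<close> or \<open>(-1, -1)\<close>.  Integrality of \<open>m\<close> makes the number of nonzero blocks even: none for \<open>Na\<close>, two
  for \<open>Ne\<close>, all four for \<open>Nz\<close>.
\<close>

lemma roots_orthogonal_to_p_inf_odd:
  assumes root: "nrm (x, m, n) = 2" and ab: "a = 1" "b = 0"
    and n: "\<nexists>\<nu>. \<nu> \<in> gaussian \<and> n = 2 * \<nu>"
  shows "\<exists>v\<in>D. (x, m, n) = sroot v"
proof -
  note blk = odd_level_blocks[OF root ab(2) n]
  have "2 * (n + 1) = 0"
    using column_difference ab blk(1) by (simp add: sum_subtractf algebra_simps)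
  then have "n + 1 = 0" by (simp only: mult_eq_0_iff) simp
  then have n1: "n = -1" by (simp add: add_eq_0_iff2)
  define K where "K = {k. fst (x $ k) = -1}"
  have t: "fst (x $ k) = 0 \<or> fst (x $ k) = -1" for k
    using blk(2)[of k] gnorm_twice_plus_one_eq_1D[of "fst (x $ k)"] coord_gaussian n1 by simp
  have x: "x $ k = (if k \<in> K then (-1, -1) else (0, 0))" for k
    using blk(1)[of k] t[of k] by (auto simp: K_def prod_eq_iff)
  have "(\<Sum>k\<in>UNIV. fst (x $ k)) = (\<Sum>k\<in>UNIV. - of_bool (k \<in> K))"
    by (rule sum.cong) (auto simp: x)
  also have "\<dots> = - of_nat (card K)" by (simp add: sum_negf)
  finally have cols: "(\<Sum>k\<in>UNIV. fst (x $ k)) = - of_nat (card K)"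
    "(\<Sum>k\<in>UNIV. snd (x $ k)) = - of_nat (card K)"
    using blk(1) by simp_all
  have "2 * (p * (m + 1)) = 2 * p * m + 2 * p" by (simp add: algebra_simps)
  also have "\<dots> = 2 * of_nat (card K)"
    unfolding two_pm_eq cols n1 ab by simp
  finally have pm: "p * (m + 1) = of_nat (card K)" by simp
  have "gnorm (p * (m + 1)) = 2 * gnorm (m + 1)"
    using coord_gaussian by (subst gnorm_mult) auto
  then have "even (card K * card K)" unfolding pm gnorm_of_nat by simp
  then have "even (card K)" by simp
  moreover have "card K \<le> 4" using card_mono[of "UNIV :: 4 set" K] by simp
  ultimately have "card K = 0 \<or> card K = 2 \<or> card K = 4" by presburger
  then consider "card K = 0" | "card K = 2" | "card K = CARD(4)" by fastforce
  then show ?thesis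
  proof cases
    case 1
    have "p * (m + 1) = p * 0" using pm 1 by simp
    then have "m + 1 = 0" using p_neq_0 unfolding mult_cancel_left by blast
    then have "m = -1" by (simp add: add_eq_0_iff2)
    moreover have "K = {}" using 1 by simp
    ultimately have "(x, m, n) = sroot Na" using n1 x by (simp add: vec_eq_iff)
    moreover have "Na \<in> D" by (simp add: D_def)
    ultimately show ?thesis by blast
  next
    case 2
    then obtain j k where "K = {j, k}" "j \<noteq> k" by (auto simp: card_2_iff)
    then obtain j k where jk: "K = {j, k}" "j < k"
      by (metis insert_commute linorder_neqE)
    have "p * (m + 1) = p * (1 - \<i>)" using pm 2 by (simp add: p_def algebra_simps)
    then have "m + 1 = 1 - \<i>" using p_neq_0 unfolding mult_cancel_left by blast
    then have "m = - \<i>" by (simp add: complex_eq_iff)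
    then have "(x, m, n) = sroot (Ne j k)" using n1 x jk by (simp add: vec_eq_iff)
    moreover have "Ne j k \<in> D" using jk by (auto simp: D_def)
    ultimately show ?thesis by blast
  next
    case 3
    have "p * (m + 1) = p * (2 - 2 * \<i>)" using pm 3 by (simp add: p_def algebra_simps)
    then have "m + 1 = 2 - 2 * \<i>" using p_neq_0 unfolding mult_cancel_left by blast
    then have "m = 1 - 2 * \<i>" by (simp add: complex_eq_iff)
    moreover have "K = UNIV" using 3 by (simp add: card_eq_UNIV_imp_eq_UNIV)
    ultimately have "(x, m, n) = sroot Nz" using n1 x by (simp add: vec_eq_iff)
    moreover have "Nz \<in> D" by (simp add: D_def)
    ultimately show ?thesis by blast
  qed
qed

lemma listed_if_heights_normalized:
  assumes "nrm (x, m, n) = 2" "a = 0 \<and> b = \<i> \<or> a = 1 \<and> b = 0"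
  shows "\<exists>v\<in>D. (x, m, n) = sroot v"
  using assms roots_orthogonal_to_l_inf roots_orthogonal_to_p_inf_even
    roots_orthogonal_to_p_inf_odd by blast

end

section \<open>The roots closest to \<open>tau\<close>\<close>

text \<open>
  The factor \<open>exp (- \<pi> \<i> / 4)\<close> in \<open>tau\<close> is \<open>cnj p / sqrt 2\<close>; it makes the cross term \<open>sqrt 2\<close> times
  the real part of the Gaussian integer \<open>p * a * cnj b\<close>.
\<close>

lemma herm_tau:
  assumes "herm l_inf r = cnj p * a" "herm p_inf r = cnj p * b"
  shows "(cmod (herm r tau))\<^sup>2 = 2 * ((cmod a)\<^sup>2 + (cmod b)\<^sup>2 - sqrt 2 * Re (p * a * cnj b))"
proof -
  have "herm tau r = cnj p * ((1 + \<i>) / sqrt 2 * a - b)"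
    unfolding tau_def exp_tau herm_diff_left herm_cscale_left assms
    by (simp add: algebra_simps)
  moreover have "cmod (herm r tau) = cmod (herm tau r)"
    by (metis complex_mod_cnj herm_cnj)
  moreover have "(cmod (cnj p))\<^sup>2 = 2" by (simp add: p_def cmod_power2)
  ultimately have "(cmod (herm r tau))\<^sup>2 = 2 * (cmod ((1 + \<i>) / sqrt 2 * a - b))\<^sup>2"
    by (simp add: norm_mult power_mult_distrib)
  also have "(cmod ((1 + \<i>) / sqrt 2 * a - b))\<^sup>2
      = (cmod a)\<^sup>2 + (cmod b)\<^sup>2 - sqrt 2 * Re (p * a * cnj b)"
  proof -
    define s where "s = sqrt 2"
    have s: "s * s = 2" "s \<noteq> 0" by (simp_all add: s_def)
    have "(1 + \<i>) / s * a = of_real (1 / s) * (p * a)" by (simp add: p_def)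
    also have "1 / s = s / 2" using s by (simp add: field_simps)
    finally have w: "(1 + \<i>) / s * a = of_real (s / 2) * (p * a)" .
    have "(cmod (of_real (s / 2) * (p * a)))\<^sup>2 = (s / 2)\<^sup>2 * ((cmod p)\<^sup>2 * (cmod a)\<^sup>2)"
      by (simp add: norm_mult power_mult_distrib power_divide)
    also have "\<dots> = (cmod a)\<^sup>2"
      by (simp add: s_def power_divide p_def cmod_power2)
    finally have "(cmod (of_real (s / 2) * (p * a)))\<^sup>2 = (cmod a)\<^sup>2" .
    moreover have "(cmod (u - v))\<^sup>2 = (cmod u)\<^sup>2 + (cmod v)\<^sup>2 - 2 * Re (u * cnj v)" for u v
      by (simp add: cmod_power2) (simp add: power2_eq_square algebra_simps)
    moreover have "2 * Re (of_real (s / 2) * (p * a) * cnj b) = s * Re (p * a * cnj b)"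
      by (simp add: field_simps)
    ultimately show ?thesis unfolding s_def[symmetric] w by simp
  qed
  finally show ?thesis .
qed

lemma cscale_cscale: "cscale c (cscale d v) = cscale (c * d) v"
  by (cases v) (simp add: vec_eq_iff mult.assoc)

lemma cscale_1: "cscale 1 v = v"
  by (cases v) (simp add: vec_eq_iff)

lemma nrm_cscale: "nrm (cscale c v) = (cmod c)\<^sup>2 * nrm v"
  by (simp add: nrm_def herm_cscale_left herm_cscale_right cmod_power2)
     (simp add: power2_eq_square algebra_simps herm_self)

lemma D4_scale: "c \<in> gaussian \<Longrightarrow> y \<in> D4 \<Longrightarrow> (c * fst y, c * snd y) \<in> D4"
  by (auto simp: D4_def) (metis distrib_left gaussian_closed(3) mult.left_commute)

lemma is_root_cscale:
  assumes "is_root r" "c \<in> gaussian" "cmod c = 1"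
  shows "is_root (cscale c r)"
proof -
  have "nrm (cscale c r) = 2" using assms by (simp add: nrm_cscale is_root_def)
  moreover have "cscale c r \<in> L" using assms by (cases r) (auto simp: is_root_def L_def D4_scale)
  ultimately show ?thesis by (simp add: is_root_def)
qed

text \<open>
  By \<open>heights_bound\<close> and \<open>no_root_orthogonal_to_both_cusps\<close> one height is a unit and the other is 0.
  Multiplying the root by a unit normalizes the nonzero height to that of the listed roots.
\<close>

lemma near_root_is_listed:
  assumes r: "is_root r" and near: "(cmod (herm r tau))\<^sup>2 \<le> 2"
  obtains v c where "v \<in> D" "cmod c = 1" "r = cscale c (sroot v)"
proof -
  define a b where "a = herm l_inf r / cnj p" and "b = herm p_inf r / cnj p"
  have ab: "herm l_inf r = cnj p * a" "herm p_inf r = cnj p * b"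
    using p_neq_0 by (simp_all add: a_def b_def)
  note found = that
  have unit: thesis
    if c: "c \<in> gaussian" "gnorm c = 1" "c * a = 0 \<and> c * b = \<i> \<or> c * a = 1 \<and> c * b = 0" for c
  proof -
    have c1: "cmod c = 1"
      using real_gnorm[OF c(1)] c(2) by (simp add: power2_eq_1_iff)
         (use norm_ge_zero[of c] in linarith)
    obtain x m n where xmn: "cscale c r = (x, m, n)" by (metis prod_cases3)
    have "is_root (x, m, n)" using is_root_cscale[OF r c(1) c1] xmn by simp
    moreover have "cusp_heights x m n (c * a) (c * b)"
      using \<open>is_root (x, m, n)\<close> ab unfolding xmn[symmetric]
      by unfold_locales (simp_all add: is_root_def herm_cscale_right xmn[symmetric])
    ultimately obtain v where v: "v \<in> D" "cscale c r = sroot v"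
      using cusp_heights.listed_if_heights_normalized[of x m n "c * a" "c * b"] c(3) xmn by (auto simp: is_root_def)
    have "cnj c * c = 1" using c1 by (metis complex_norm_square mult.commute of_real_1 one_power2)
    then have "r = cscale (cnj c) (sroot v)"
      unfolding v(2)[symmetric] by (simp add: cscale_cscale cscale_1)
    then show thesis using found v(1) c1 by (metis complex_mod_cnj)
  qed
  obtain x m n where xmn: "r = (x, m, n)" by (metis prod_cases3)
  interpret cusp_heights x m n a b
    using r ab xmn by unfold_locales (auto simp: is_root_def)
  have root: "nrm (x, m, n) = 2" using r xmn by (simp add: is_root_def)
  have le: "gnorm a + gnorm b \<le> 1"
    using near herm_tau[OF ab] by (intro heights_bound root) simp
  have inv: "cnj z * z = 1" if "z \<in> gaussian" "gnorm z = 1" for z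
    using real_gnorm[OF that(1)] that(2) complex_norm_square[of z] by (simp add: mult.commute)
  show thesis
  proof (cases "a = 0")
    case True
    then have "b \<noteq> 0" using no_root_orthogonal_to_both_cusps root by blast
    then have "gnorm b = 1" using le gnorm_eq_0[OF gaussian_b] by linarith
    then show thesis
      using unit[of "\<i> * cnj b"] True inv[OF gaussian_b] gaussian_b
      by (simp add: gnorm_mult mult.assoc) (simp add: gnorm_def)
  next
    case False
    then have "gnorm a = 1" "gnorm b = 0" using le gnorm_eq_0[OF gaussian_a] by linarith+
    then show thesis
      using unit[of "cnj a"] inv[OF gaussian_a] gaussian_a gnorm_eq_0[OF gaussian_b] by simp
  qed
qed

lemma sroot_heights:
  assumes "v \<in> D"
  shows "herm l_inf (sroot v) = cnj p \<and> herm p_inf (sroot v) = 0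
    \<or> herm l_inf (sroot v) = 0 \<and> herm p_inf (sroot v) = p"
proof -
  let ?P = "\<lambda>v. herm l_inf (sroot v) = cnj p \<and> herm p_inf (sroot v) = 0"
  let ?Q = "\<lambda>v. herm l_inf (sroot v) = 0 \<and> herm p_inf (sroot v) = p"
  have "?P Na" "?P Nz"
    by (simp_all add: herm_l_inf herm_p_inf p_def complex_eq_iff)
  moreover have "\<forall>k. ?P (Nc k)" "\<forall>k. ?P (Ng k)" "\<forall>j k. j \<noteq> k \<longrightarrow> ?P (Ne j k)"
    "\<forall>k. ?Q (Nb k)" "\<forall>k. ?Q (Nd k)" "\<forall>k. ?Q (Nf k)" "\<forall>k. ?Q (Nh k)"
    unfolding all4 by (simp_all add: herm_l_inf herm_p_inf sum4' p_def complex_eq_iff)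
  moreover have "j \<noteq> k" if "v = Ne j k" for j k using that assms by (auto simp: D_def)
  ultimately show ?thesis by (cases v) (simp_all del: sroot.simps)
qed

lemma herm_sroot_tau:
  assumes "v \<in> D"
  shows "(cmod (herm (sroot v) tau))\<^sup>2 = 2"
  using sroot_heights[OF assms] herm_tau[of "sroot v" 1 0] herm_tau[of "sroot v" 0 \<i>] cnj_p_times_i
  by auto

lemma two_le_herm_root_tau:
  assumes "is_root r"
  shows "2 \<le> (cmod (herm r tau))\<^sup>2"
proof (rule ccontr)
  assume "\<not> 2 \<le> (cmod (herm r tau))\<^sup>2"
  then have less: "(cmod (herm r tau))\<^sup>2 < 2" by simp
  obtain v c where "v \<in> D" "cmod c = 1" "r = cscale c (sroot v)"
    using near_root_is_listed[OF assms less_imp_le[OF less]] .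
  then have "(cmod (herm r tau))\<^sup>2 = 2"
    using herm_sroot_tau by (simp add: herm_cscale_left norm_mult)
  with less show False by simp
qed

section \<open>A mirror determines its root up to a scalar\<close>

lemma cline_in_mirror_iff:
  assumes "nrm v < 0"
  shows "cline v \<in> mirror r \<longleftrightarrow> herm r v = 0"
proof -
  have "v \<in> cline v" unfolding cline_def by (metis cscale_1 rangeI)
  moreover have "cline v \<in> hyp" using assms unfolding hyp_def by blast
  ultimately show ?thesis by (auto simp: mirror_def cline_def herm_cscale_right)
qed

lemma mirror_cscale: "c \<noteq> 0 \<Longrightarrow> mirror (cscale c r) = mirror r"
  by (simp add: mirror_def herm_cscale_left)

text \<open>
  Exchanging the two hyperbolic coordinates, with factors \<open>cnj p\<close> and \<open>p\<close>, gives a partner with which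
  the product of \<open>v\<close> is a positive definite function of \<open>v\<close>.
\<close>

lemma herm_nondegenerate:
  assumes "\<And>w. herm v w = 0"
  shows "v = 0"
proof -
  obtain x m n where v: "v = (x, m, n)" by (metis prod_cases3)
  have "Re (herm v (x, cnj p * n, p * m)) =
     (\<Sum>k\<in>UNIV. (cmod (fst (x $ k)))\<^sup>2 + (cmod (snd (x $ k)))\<^sup>2) + 2 * ((cmod m)\<^sup>2 + (cmod n)\<^sup>2)"
    unfolding v herm.simps
    by (simp add: cmod_power2 p_def) (simp add: power2_eq_square algebra_simps sum.distrib)
  moreover have "(\<Sum>k\<in>UNIV. (cmod (fst (x $ k)))\<^sup>2 + (cmod (snd (x $ k)))\<^sup>2) \<ge> 0"
    by (intro sum_nonneg) simp
  moreover have "(cmod m)\<^sup>2 \<ge> 0" "(cmod n)\<^sup>2 \<ge> 0" by simp_all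
  ultimately have "(\<Sum>k\<in>UNIV. (cmod (fst (x $ k)))\<^sup>2 + (cmod (snd (x $ k)))\<^sup>2) = 0
      \<and> (cmod m)\<^sup>2 = 0 \<and> (cmod n)\<^sup>2 = 0"
    unfolding assms by (simp add: add_nonneg_eq_0_iff eq_commute[of 0])
  then show ?thesis
    by (simp add: v vec_eq_iff prod_eq_iff sum_nonneg_eq_0_iff add_nonneg_eq_0_iff)
qed

lemma nrm_add_cscale:
  "nrm (u + cscale c v) = nrm u + 2 * Re (c * herm u v) + (cmod c)\<^sup>2 * nrm v"
proof -
  have "herm v u = cnj (herm u v)" by (simp add: herm_cnj)
  then show ?thesis
    by (simp add: nrm_def herm_add_left herm_add_right herm_cscale_left herm_cscale_right cmod_power2)
       (simp add: power2_eq_square algebra_simps herm_self)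
qed

text \<open>
  The hyperplane orthogonal to \<open>r\<close> contains a negative vector \<open>t\<close>, so its negative vectors form a
  nonempty open subset and therefore span it.  So \<open>r'\<close> is orthogonal to everything orthogonal
  to \<open>r\<close>, and nondegeneracy makes it a multiple of \<open>r\<close>.
\<close>

lemma mirror_determines_root:
  assumes r: "0 < nrm r" and sub: "mirror r \<subseteq> mirror r'"
  obtains c where "r' = cscale c r"
proof -
  define N where "N = nrm r"
  have rr: "herm r r = of_real N" and N: "0 < N" using herm_self[of r] r by (simp_all add: N_def)
  have proj: "herm r (w + cscale (- herm r w / of_real N) r) = 0" for w
    using N by (simp add: herm_add_right herm_cscale_right rr)
  have neg: "herm r' w = 0" if "nrm w < 0" "herm r w = 0" for w
    using that sub cline_in_mirror_iff by blast
  \<comment> \<open>Projecting \<open>tau\<close> to the hyperplane only lowers its norm.\<close>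
  define t where "t = tau + cscale (- herm r tau / of_real N) r"
  have t: "herm r t = 0" unfolding t_def by (rule proj)
  have "Re (- herm r tau / of_real N * herm tau r) = - (cmod (herm r tau))\<^sup>2 / N"
    unfolding herm_cnj[of r tau, symmetric]
    by (simp add: cmod_power2) (simp add: power2_eq_square add_divide_distrib diff_divide_distrib)
  moreover have "(cmod (- herm r tau / of_real N))\<^sup>2 * N = (cmod (herm r tau))\<^sup>2 / N"
    using N by (simp add: norm_divide power_divide power2_eq_square)
  ultimately have "nrm t = nrm tau - (cmod (herm r tau))\<^sup>2 / N"
    unfolding t_def nrm_add_cscale N_def[symmetric] by (simp only:)
  moreover have "(cmod (herm r tau))\<^sup>2 / N \<ge> 0" "nrm tau < 0" using N by (simp_all add: nrm_tau)
  ultimately have t_neg: "nrm t < 0" by linarith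
  have perp: "herm r' w = 0" if w: "herm r w = 0" for w
  proof -
    have "((\<lambda>\<delta>. nrm (t + cscale (of_real \<delta>) w)) \<longlongrightarrow> nrm t) (at_right 0)"
      unfolding nrm_add_cscale by (auto intro!: tendsto_eq_intros)
    then have "\<forall>\<^sub>F \<delta> in at_right 0. nrm (t + cscale (of_real \<delta>) w) < 0"
      using t_neg by (rule order_tendstoD)
    moreover have "\<forall>\<^sub>F \<delta> in at_right 0. (0::real) < \<delta>" by (rule eventually_at_right_less)
    ultimately have "\<forall>\<^sub>F \<delta> in at_right 0. nrm (t + cscale (of_real \<delta>) w) < 0 \<and> 0 < \<delta>"
      by (rule eventually_conj)
    then obtain \<delta> :: real where \<delta>: "nrm (t + cscale (of_real \<delta>) w) < 0" "0 < \<delta>"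
      using eventually_happens[of _ "at_right (0::real)"] by auto
    have "herm r' (t + cscale (of_real \<delta>) w) = 0"
      using \<delta>(1) t w by (intro neg) (simp_all add: herm_add_right herm_cscale_right)
    then show ?thesis
      using neg[OF t_neg t] \<delta>(2) by (simp add: herm_add_right herm_cscale_right)
  qed
  have "r' - cscale (cnj (herm r' r / of_real N)) r = 0"
  proof (rule herm_nondegenerate)
    fix w
    show "herm (r' - cscale (cnj (herm r' r / of_real N)) r) w = 0"
      using perp[OF proj[of w]]
      by (simp add: herm_add_right herm_cscale_right herm_diff_left herm_cscale_left)
  qed
  then show thesis using that by simp
qed

lemma fun_if_eq_iff:
  assumes "u \<noteq> w"
  shows "(\<lambda>i. if P i then u else w) = (\<lambda>i. if Q i then u else w) \<longleftrightarrow> P = Q"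
  using assms by (auto simp: fun_eq_iff)

text \<open>
  The last two coordinates distinguish the nine families, except \<open>Nc\<close> from \<open>Nd\<close>; the remaining pairs
  differ in the blocks.
\<close>

lemma inj_on_sroot: "inj_on sroot D"
proof (rule inj_onI)
  fix v w assume D: "v \<in> D" "w \<in> D" and eq: "sroot v = sroot w"
  have single: "(\<lambda>i. i = k) = (\<lambda>i. i = l) \<longleftrightarrow> k = l" for k l :: 4
    by metis
  have pair: "(\<lambda>i. i = j \<or> i = k) = (\<lambda>i. i = j' \<or> i = k') \<longleftrightarrow> j = j' \<and> k = k'" if "j < k" "j' < k'"
    for j k j' k' :: 4
    using that by (metis order_less_asym order_less_irrefl)
  have order: "j < k" if "Ne j k \<in> D" for j k using that by (auto simp: D_def)
  have neq: "(\<lambda>i. if i = k then (-1, 1::complex) else (0, 0)) \<noteq> (\<lambda>i. if i = l then (-p, 0) else (0, 0))"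
    for k l :: 4 by (auto simp: fun_eq_iff intro!: exI[of _ k])
  show "v = w"
    using eq D p_neq_0
    by (cases v; cases w)
      (simp_all add: fun_if_eq_iff single pair order neq neq[symmetric],
       simp_all add: p_def complex_eq_iff)
qed

lemma inj_on_mirror_sroot: "inj_on (\<lambda>v. mirror (sroot v)) D"
proof (rule inj_onI)
  fix v w assume D: "v \<in> D" "w \<in> D" and eq: "mirror (sroot v) = mirror (sroot w)"
  have "0 < nrm (sroot v)" using sroot_is_root[OF D(1)] by (simp add: is_root_def)
  then obtain c where c: "sroot w = cscale c (sroot v)"
    using mirror_determines_root eq by blast
  have "c = 1"
    using p_neq_0 sroot_heights[OF D(1)] sroot_heights[OF D(2)] unfolding c herm_cscale_right by auto
  then have "sroot w = sroot v" using c by (simp add: cscale_1)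
  then show "v = w" using inj_on_sroot D by (simp add: inj_on_eq_iff)
qed

lemma mirror_dist_tau_le_iff:
  assumes "is_root r" "is_root r'"
  shows "mirror_dist r tau \<le> mirror_dist r' tau \<longleftrightarrow> (cmod (herm r tau))\<^sup>2 \<le> (cmod (herm r' tau))\<^sup>2"
proof -
  have "nrm r = 2" "nrm r' = 2" using assms by (simp_all add: is_root_def)
  moreover have "arsinh x \<le> arsinh y \<longleftrightarrow> x \<le> y" for x y :: real
    by (meson arsinh_less_iff_real not_le)
  ultimately show ?thesis
    by (simp add: mirror_dist_def nrm_tau divide_le_cancel)
qed

theorem theorem5p6:
  shows "closest_mirrors tau = (\<lambda>v. mirror (sroot v)) ` D
    \<and> card ((\<lambda>v. mirror (sroot v)) ` D) = 32
    \<and> (\<forall>M\<in>mirrors. cline tau \<notin> M)"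
proof (intro conjI ballI)
  have listed: "\<exists>v\<in>D. mirror r = mirror (sroot v)" if r: "is_root r" "(cmod (herm r tau))\<^sup>2 \<le> 2" for r
  proof -
    obtain v c where "v \<in> D" "cmod c = 1" "r = cscale c (sroot v)"
      using near_root_is_listed[OF r] .
    then show ?thesis using mirror_cscale[of c "sroot v"] by (metis norm_zero zero_neq_one)
  qed
  have Na: "Na \<in> D" by (simp add: D_def)
  show "closest_mirrors tau = (\<lambda>v. mirror (sroot v)) ` D"
  proof
    show "closest_mirrors tau \<subseteq> (\<lambda>v. mirror (sroot v)) ` D"
    proof
      fix M assume "M \<in> closest_mirrors tau"
      then obtain r where M: "M = mirror r" and r: "is_root r"
        and closest: "\<And>r'. is_root r' \<Longrightarrow> mirror_dist r tau \<le> mirror_dist r' tau"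
        by (auto simp: closest_mirrors_def)
      have "(cmod (herm r tau))\<^sup>2 \<le> (cmod (herm (sroot Na) tau))\<^sup>2"
        using closest[OF sroot_is_root[OF Na]]
          mirror_dist_tau_le_iff[OF r sroot_is_root[OF Na]] by (rule iffD1[rotated])
      then have "(cmod (herm r tau))\<^sup>2 \<le> 2" unfolding herm_sroot_tau[OF Na] .
      then show "M \<in> (\<lambda>v. mirror (sroot v)) ` D" using listed[OF r] M by blast
    qed
  next
    show "(\<lambda>v. mirror (sroot v)) ` D \<subseteq> closest_mirrors tau"
    proof
      fix M assume "M \<in> (\<lambda>v. mirror (sroot v)) ` D"
      then obtain v where v: "v \<in> D" "M = mirror (sroot v)" by blast
      have "mirror_dist (sroot v) tau \<le> mirror_dist r' tau" if "is_root r'" for r'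
        using that two_le_herm_root_tau herm_sroot_tau[OF v(1)]
        by (simp only: mirror_dist_tau_le_iff[OF sroot_is_root[OF v(1)]])
      then show "M \<in> closest_mirrors tau"
        using v sroot_is_root unfolding closest_mirrors_def by blast
    qed
  qed
  show "card ((\<lambda>v. mirror (sroot v)) ` D) = 32"
    using inj_on_mirror_sroot by (simp add: card_image card_D)
next
  fix M assume "M \<in> mirrors"
  then obtain r where r: "is_root r" "M = mirror r" by (auto simp: mirrors_def)
  have "herm r tau \<noteq> 0" using two_le_herm_root_tau[OF r(1)] by auto
  then show "cline tau \<notin> M"
    using r(2) cline_in_mirror_iff[of tau r] by (simp add: nrm_tau)
qed

end
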